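(* Consider the multilayer scheme described in the context. Assume a CFL condition of the type $$\Delta t\,\max\Big(\frac{m_{\partial K}}{m_K},\frac{m_{\partial K_e}}{m_{K_e}}\Big)\left(|\overline{\mathbf u}^n_{e,i}\cdot\mathbf n_{e,K}|+\sqrt{\gamma}\,\sqrt{\frac{|\boldsymbol\delta\Phi^n_{e,i}|}{\varepsilon^2}}\right)\le\Big(\frac{\beta}{\beta+1}\Big)\xi^n_{e,i}$$ for each edge $e=\partial K\cap\partial K_e$, where $0<\beta\le1$ and $$\xi^n_{e,i}=\frac{\min\big(H^n_{K,i},H^n_{K_e,i}\big)}{\max\big(\widehat H^n_{K,i},\widehat H^n_{K_e,i},H^n_{K,i},H^n_{K_e,i}\big)}.$$ Then $$H^{n+1}_{K,i}\ge\frac1\beta\,\frac{\Delta t}{m_K}\sum_{e\in\partial K}-\big(\mathcal F^n_{e,i}\cdot\mathbf n_{e,K}\big)^-m_e\ge0 .$$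
   Context: Mesh. $\mathbb T$ is a tessellation of a computational domain $\Omega\subset\mathbb R^2$ into cells $K$. $m_K$ is the area of $K$, $m_{\partial K}$ its perimeter; for an edge $e\in\partial K$, $m_e$ is its length, $K_e$ the neighbour of $K$ across $e$, and $\mathbf n_{e,K}$ the unit normal to $e$ outward from $K$, pointing to $K_e$. Unknowns. $L\ge1$ layers; for each cell $K$, layer $i$ and time index $n$: mass $H^n_{K,i}$ (nonnegative), velocity $\mathbf u^n_{K,i}\in\mathbb R^2$ and scalar potential $\Phi^n_{K,i}$ (a function of the masses of all layers in $K$ and of position). $\varepsilon>0$ is the Froude number, $\Delta t>0$ the time step, $\gamma,\alpha\ge0$ are stabilization constants, and $C_{\mathcal H}$ is a uniform bound on the $L^2$ (operator) norm of the matrix $\mathcal H_{ij}=\partial_{H_j}\Phi_i$. The weight $\widehat H^n_{K,i}$ equals $H^n_{K,i}$ in practice (and $(H^n_{K,i})^2/H^{n+1}_{K,i}$ in the associated non-linear stability analysis). Notation. For piecewise constant scalar $w$: $\overline w_e=\frac12(w_{K_e}+w_K)$, $\boldsymbol\delta w_e=\frac12(w_{K_e}-w_K)\mathbf n_{e,K}$. For piecewise constant vector $\mathbf w$: $\overline{\mathbf w}_e=\frac12(\mathbf w_{K_e}+\mathbf w_K)$, $\delta\mathbf w_e=\frac12(\mathbf w_{K_e}-\mathbf w_K)\cdot\mathbf n_{e,K}$. $w^\pm=\frac12(w\pm|w|)$. Scheme. For all $K$ and $i$, $$H^{n+1}_{K,i}=H^n_{K,i}-\frac{\Delta t}{m_K}\sum_{e\in\partial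 K}(\mathcal F^n_{e,i}\cdot\mathbf n_{e,K})m_e,$$ $$H^{n+1}_{K,i}\mathbf u^{n+1}_{K,i}=H^n_{K,i}\mathbf u^n_{K,i}-\frac{\Delta t}{m_K}\sum_{e\in\partial K}\Big(\mathbf u^n_{K,i}(\mathcal F^n_{e,i}\cdot\mathbf n_{e,K})^++\mathbf u^n_{K_e,i}(\mathcal F^n_{e,i}\cdot\mathbf n_{e,K})^-\Big)m_e-\frac{\Delta t}{m_K}H^n_{K,i}\sum_{e\in\partial K}\frac{\Phi^{n,\ast}_{e,i}}{\varepsilon^2}\mathbf n_{e,K}m_e,$$ with numerical fluxes and discrete potential $$\mathcal F^n_{e,i}=\overline{H\mathbf u}^n_{e,i}-\Pi^n_{e,i},\quad \Pi^n_{e,i}=\gamma\Delta t\Big(\frac{\widehat H}{\Delta}\Big)^n_{e,i}\frac{\boldsymbol\delta\Phi^n_{e,i}}{\varepsilon^2},\qquad \Phi^{n,\ast}_{e,i}=\overline\Phi^n_{e,i}-\Lambda^n_{e,i},\quad \Lambda^n_{e,i}=\alpha\Delta t\,\frac{C_{\mathcal H}}{\Delta_e}\,\delta(H\mathbf u)^n_{e,i},$$ $$\Big(\frac{\widehat H}{\Delta}\Big)^n_{e,i}=\frac12\Big(\widehat H^n_{K,i}\frac{m_{\partial K}}{2m_K}+\widehat H^n_{K_e,i}\frac{m_{\partial K_e}}{2m_{K_e}}\Big),\qquad \frac1{\Delta_e}=\frac12\Big(\frac{m_{\partial K}}{m_K}+\frac{m_{\partial K_e}}{m_{K_e}}\B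ig).$$
   Formalization: In the CFL condition, the absolute value of the mean normal velocity is replaced by the mean over the two cells of |u·n|; as printed the claim fails when normal velocities oppose and the masses differ, since the flux uses the mean of Hu. *)

theory Defs
  imports "HOL-Analysis.Analysis"
begin

section \<open>Mesh\<close>

type_synonym cell = "(real^2) set"
type_synonym edge = "(real^2) set"

record mesh =
  domain :: "(real^2) set"
  cells :: "cell set"
  edges :: "cell \<Rightarrow> edge set"
  neighbour :: "cell \<Rightarrow> edge \<Rightarrow> cell"
  normal :: "cell \<Rightarrow> edge \<Rightarrow> real^2"

definition is_edge :: "edge \<Rightarrow> bool" where
  "is_edge e \<longleftrightarrow> (\<exists>a b. a \<noteq> b \<and> e = closed_segment a b)"

text \<open>Polygonal cells, not necessarily convex. A straight side may be split into several edges,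
  so non-conforming meshes are included.\<close>

definition polygonal_cell :: "cell \<Rightarrow> edge set \<Rightarrow> bool" where
  "polygonal_cell K E \<longleftrightarrow>
     compact K \<and> interior K \<noteq> {} \<and> K = closure (interior K) \<and>
     finite E \<and> (\<forall>e\<in>E. is_edge e) \<and> frontier K = \<Union>E \<and>
     (\<forall>e\<in>E. \<forall>f\<in>E. e \<noteq> f \<longrightarrow> rel_interior e \<inter> f = {})"

definition outward_unit_normal :: "cell \<Rightarrow> edge \<Rightarrow> real^2 \<Rightarrow> bool" where
  "outward_unit_normal K e \<nu> \<longleftrightarrow>
     norm \<nu> = 1 \<and> (\<forall>x\<in>e. \<forall>y\<in>e. (x - y) \<bullet> \<nu> = 0) \<and>
     (\<forall>x\<in>rel_interior e. \<forall>\<^sub>F t in at_right 0. x - t *\<^sub>R \<nu> \<in> K \<and> x + t *\<^sub>R \<nu> \<notin> K)"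

text \<open>Every edge of a cell has a neighbouring cell. Inside the domain this is the other cell having
  the edge as one of its own; on the boundary of the domain it is the cell which the boundary
  condition puts across the edge (as for periodic boundaries), and nothing else is required of it.
  The domain may also be the whole plane, with infinitely many cells.\<close>

definition tessellation :: "mesh \<Rightarrow> bool" where
  "tessellation M \<longleftrightarrow>
     open (domain M) \<and> \<Union>(cells M) = closure (domain M) \<and>
     (\<forall>K\<in>cells M. \<forall>K'\<in>cells M. K \<noteq> K' \<longrightarrow> interior K \<inter> interior K' = {}) \<and>
     (\<forall>K\<in>cells M. polygonal_cell K (edges M K) \<and>
        (\<forall>e\<in>edges M K.
           outward_unit_normal K e (normal M K e) \<and>
           neighbour M K e \<in> cells M \<and>
           (\<not> e \<subseteq> frontier (domain M) \<longrightarrow>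
              neighbour M K e \<noteq> K \<and> e \<in> edges M (neighbour M K e))))"

definition area :: "cell \<Rightarrow> real" where
  "area K = measure lebesgue K"

text \<open>An edge is a segment, so its diameter is its length.\<close>

definition edge_length :: "edge \<Rightarrow> real" where
  "edge_length e = diameter e"

definition perimeter :: "mesh \<Rightarrow> cell \<Rightarrow> real" where
  "perimeter M K = (\<Sum>e\<in>edges M K. edge_length e)"


section \<open>Means and jumps of piecewise constant fields\<close>

definition edge_mean :: "mesh \<Rightarrow> (cell \<Rightarrow> 'v::real_vector) \<Rightarrow> cell \<Rightarrow> edge \<Rightarrow> 'v" where
  "edge_mean M w K e = (1/2) *\<^sub>R (w (neighbour M K e) + w K)"

definition scalar_jump :: "mesh \<Rightarrow> (cell \<Rightarrow> real) \<Rightarrow> cell \<Rightarrow> edge \<Rightarrow> real^2" where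
  "scalar_jump M w K e = ((1/2) * (w (neighbour M K e) - w K)) *\<^sub>R normal M K e"

definition vector_jump :: "mesh \<Rightarrow> (cell \<Rightarrow> real^2) \<Rightarrow> cell \<Rightarrow> edge \<Rightarrow> real" where
  "vector_jump M w K e = ((1/2) *\<^sub>R (w (neighbour M K e) - w K)) \<bullet> normal M K e"

definition pos_part :: "real \<Rightarrow> real" where
  "pos_part w = (1/2) * (w + \<bar>w\<bar>)"

text \<open>The negative part is nonpositive.\<close>

definition neg_part :: "real \<Rightarrow> real" where
  "neg_part w = (1/2) * (w - \<bar>w\<bar>)"


section \<open>Unknowns and scheme\<close>

record params =
  froude :: real
  time_step :: real
  gam :: real
  alp :: real
  hess_bound :: real

text \<open>The discrete unknowns at one time level. The layers are the elements of the index type, so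
  their number is \<^term>\<open>CARD('l)\<close>; \<open>weight\<close> is the mass weight in the flux stabilization.\<close>

record 'l state =
  mass :: "cell \<Rightarrow> real^'l"
  velocity :: "cell \<Rightarrow> (real^2)^'l"
  potential :: "cell \<Rightarrow> real^'l"
  weight :: "cell \<Rightarrow> real^'l"

definition momentum :: "('l::finite) state \<Rightarrow> 'l \<Rightarrow> cell \<Rightarrow> real^2" where
  "momentum S i K = (mass S K $ i) *\<^sub>R (velocity S K $ i)"

definition weight_over_Delta :: "mesh \<Rightarrow> ('l::finite) state \<Rightarrow> 'l \<Rightarrow> cell \<Rightarrow> edge \<Rightarrow> real" where
  "weight_over_Delta M S i K e =
     (let K' = neighbour M K e in
      (1/2) * ((weight S K $ i) * (perimeter M K / (2 * area K))
             + (weight S K' $ i) * (perimeter M K' / (2 * area K'))))"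

definition inverse_Delta :: "mesh \<Rightarrow> cell \<Rightarrow> edge \<Rightarrow> real" where
  "inverse_Delta M K e =
     (let K' = neighbour M K e in
      (1/2) * (perimeter M K / area K + perimeter M K' / area K'))"

definition flux_stab ::
  "mesh \<Rightarrow> params \<Rightarrow> ('l::finite) state \<Rightarrow> 'l \<Rightarrow> cell \<Rightarrow> edge \<Rightarrow> real^2" where
  "flux_stab M P S i K e =
     (gam P * time_step P * weight_over_Delta M S i K e) *\<^sub>R
       ((1 / (froude P)\<^sup>2) *\<^sub>R scalar_jump M (\<lambda>C. potential S C $ i) K e)"

definition flux ::
  "mesh \<Rightarrow> params \<Rightarrow> ('l::finite) state \<Rightarrow> 'l \<Rightarrow> cell \<Rightarrow> edge \<Rightarrow> real^2" where
  "flux M P S i K e = edge_mean M (momentum S i) K e - flux_stab M P S i K e"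

definition potential_stab ::
  "mesh \<Rightarrow> params \<Rightarrow> ('l::finite) state \<Rightarrow> 'l \<Rightarrow> cell \<Rightarrow> edge \<Rightarrow> real" where
  "potential_stab M P S i K e =
     alp P * time_step P * (hess_bound P * inverse_Delta M K e) *
       vector_jump M (momentum S i) K e"

definition edge_potential ::
  "mesh \<Rightarrow> params \<Rightarrow> ('l::finite) state \<Rightarrow> 'l \<Rightarrow> cell \<Rightarrow> edge \<Rightarrow> real" where
  "edge_potential M P S i K e =
     edge_mean M (\<lambda>C. potential S C $ i) K e - potential_stab M P S i K e"

definition mass_equation ::
  "mesh \<Rightarrow> params \<Rightarrow> ('l::finite) state \<Rightarrow> 'l state \<Rightarrow> 'l \<Rightarrow> cell \<Rightarrow> bool" where
  "mass_equation M P S S' i K \<longleftrightarrow>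
     mass S' K $ i =
       mass S K $ i - (time_step P / area K) *
         (\<Sum>e\<in>edges M K. (flux M P S i K e \<bullet> normal M K e) * edge_length e)"

definition momentum_equation ::
  "mesh \<Rightarrow> params \<Rightarrow> ('l::finite) state \<Rightarrow> 'l state \<Rightarrow> 'l \<Rightarrow> cell \<Rightarrow> bool" where
  "momentum_equation M P S S' i K \<longleftrightarrow>
     momentum S' i K =
       momentum S i K
       - (time_step P / area K) *\<^sub>R
           (\<Sum>e\<in>edges M K. edge_length e *\<^sub>R
              (pos_part (flux M P S i K e \<bullet> normal M K e) *\<^sub>R (velocity S K $ i)
             + neg_part (flux M P S i K e \<bullet> normal M K e) *\<^sub>R
                 (velocity S (neighbour M K e) $ i)))
       - (time_step P / area K * (mass S K $ i)) *\<^sub>R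
           (\<Sum>e\<in>edges M K.
              (edge_potential M P S i K e / (froude P)\<^sup>2 * edge_length e) *\<^sub>R normal M K e)"

definition scheme_step ::
  "mesh \<Rightarrow> params \<Rightarrow> ('l::finite) state \<Rightarrow> 'l state \<Rightarrow> bool" where
  "scheme_step M P S S' \<longleftrightarrow>
     (\<forall>K\<in>cells M. \<forall>i. mass_equation M P S S' i K \<and> momentum_equation M P S S' i K)"

text \<open>The potential is a function of the masses of all layers and of position (a point \<open>pos K\<close> of
  the cell), with matrix of partial derivatives \<open>\<H>\<close> with respect to the masses; the derivatives
  are one-sided at zero mass.\<close>

definition potential_law ::
  "mesh \<Rightarrow> params \<Rightarrow> (real^'l \<Rightarrow> real^2 \<Rightarrow> real^('l::finite)) \<Rightarrow>
   (real^'l \<Rightarrow> real^2 \<Rightarrow> real^'l^'l) \<Rightarrow> bool" where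
  "potential_law M P \<phi> \<H> \<longleftrightarrow>
     (\<forall>h x. (\<forall>k. 0 \<le> h $ k) \<and> x \<in> closure (domain M) \<longrightarrow>
        (\<forall>i j. ((\<lambda>s. \<phi> (\<chi> k. if k = j then s else h $ k) x $ i)
                 has_real_derivative \<H> h x $ i $ j) (at (h $ j) within {0..})) \<and>
        onorm (\<lambda>v. \<H> h x *v v) \<le> hess_bound P)"

definition potential_from ::
  "mesh \<Rightarrow> (real^'l \<Rightarrow> real^2 \<Rightarrow> real^('l::finite)) \<Rightarrow> (cell \<Rightarrow> real^2) \<Rightarrow> 'l state \<Rightarrow> bool" where
  "potential_from M \<phi> pos S \<longleftrightarrow>
     (\<forall>K\<in>cells M. pos K \<in> K \<and> potential S K = \<phi> (mass S K) (pos K))"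


section \<open>CFL condition\<close>

text \<open>The ratio is 0 when all four masses vanish, by the convention for division by zero.\<close>

definition xi :: "mesh \<Rightarrow> ('l::finite) state \<Rightarrow> 'l \<Rightarrow> cell \<Rightarrow> edge \<Rightarrow> real" where
  "xi M S i K e =
     (let K' = neighbour M K e in
      min (mass S K $ i) (mass S K' $ i) /
      Max {weight S K $ i, weight S K' $ i, mass S K $ i, mass S K' $ i})"

text \<open>The term written \<open>\<bar>mean u \<cdot> n\<bar>\<close> in the CFL condition is taken as the mean of
  \<open>\<bar>u \<cdot> n\<bar>\<close> over the two cells. The two agree when the normal velocities have the same sign. With
  the absolute value outside the mean the positivity result fails: the term vanishes for opposite
  normal velocities, whereas the mean of the momenta, hence the flux, does not when the masses
  differ, and the time step is then not bounded.\<close>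

definition mean_normal_speed ::
  "mesh \<Rightarrow> ('l::finite) state \<Rightarrow> 'l \<Rightarrow> cell \<Rightarrow> edge \<Rightarrow> real" where
  "mean_normal_speed M S i K e = edge_mean M (\<lambda>C. \<bar>(velocity S C $ i) \<bullet> normal M K e\<bar>) K e"

definition CFL ::
  "mesh \<Rightarrow> params \<Rightarrow> real \<Rightarrow> ('l::finite) state \<Rightarrow> 'l \<Rightarrow> cell \<Rightarrow> edge \<Rightarrow> bool" where
  "CFL M P \<beta> S i K e \<longleftrightarrow>
     time_step P *
     max (perimeter M K / area K)
         (perimeter M (neighbour M K e) / area (neighbour M K e)) *
     (mean_normal_speed M S i K e +
      sqrt (gam P) *
      sqrt (norm (scalar_jump M (\<lambda>C. potential S C $ i) K e) / (froude P)\<^sup>2))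
     \<le> \<beta> / (\<beta> + 1) * xi M S i K e"

end

theory Submission
  imports Defs
begin

text \<open>An outgoing flux draws on the mass of the cell with factor \<open>1\<close>, an incoming one only with
  factor \<open>1/\<beta> - 1\<close>. So it is enough that each edge \<open>e\<close> takes at most the share \<open>m\<^sub>e / m\<^sub>\<partial>\<^sub>K\<close> of the
  mass, which amounts to the bound \<open>\<Delta>t (m\<^sub>\<partial>\<^sub>K / m\<^sub>K) |F\<^sub>e \<cdot> n| \<le> \<beta>/(\<beta>+1) H\<^sub>K\<close>. With \<open>N\<close> the maximum in the
  denominator of \<open>\<xi>\<close>, and \<open>X\<close>, \<open>Y\<close> the velocity and potential parts of the left-hand side of the CFL
  condition, the normal flux, scaled by \<open>\<Delta>t\<close> and the maximum of the two ratios of perimeter to area,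
  is at most \<open>N (X + Y\<^sup>2/2)\<close>. As \<open>Y \<le> 1\<close>, this is at most \<open>N (X + Y) \<le> \<beta>/(\<beta>+1) N \<xi>\<close>.\<close>

lemma edge_length_nonneg:
  assumes "is_edge e"
  shows "0 \<le> edge_length e"
  using assms unfolding is_edge_def edge_length_def
  by (auto intro!: diameter_ge_0 compact_imp_bounded)

lemma tessellation_edge_length_nonneg:
  assumes "tessellation M" "K \<in> cells M" "e \<in> edges M K"
  shows "0 \<le> edge_length e"
  using assms unfolding tessellation_def polygonal_cell_def
  by (meson edge_length_nonneg)

lemma perimeter_area_ratio_nonneg:
  assumes "tessellation M" "K \<in> cells M"
  shows "0 \<le> perimeter M K / area K"
  unfolding perimeter_def area_def
  by (intro divide_nonneg_nonneg sum_nonneg tessellation_edge_length_nonneg[OF assms])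
     (auto simp: assms)

lemma neg_part_nonpos: "neg_part x \<le> 0"
  by (simp add: neg_part_def)

text \<open>The potential jump points along the unit normal, so the inner product keeps its signed
  size. The flux becomes a difference of two scalars that can be bounded separately.\<close>

lemma normal_flux_eq:
  assumes "norm (normal M K e) = 1"
  shows "flux M P S i K e \<bullet> normal M K e =
    edge_mean M (\<lambda>C. mass S C $ i * (velocity S C $ i \<bullet> normal M K e)) K e
    - gam P * time_step P * weight_over_Delta M S i K e *
      ((1/2 * (potential S (neighbour M K e) $ i - potential S K $ i)) / (froude P)\<^sup>2)"
proof -
  have "normal M K e \<bullet> normal M K e = 1"
    using assms by (simp add: dot_square_norm)
  then show ?thesis
    by (simp add: flux_def flux_stab_def edge_mean_def momentum_def scalar_jump_def
        inner_diff_left inner_add_left)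
qed

text \<open>As the masses may differ, opposite velocities need not cancel in the mean of the
  momenta. The absolute values therefore stand inside the mean, as in
  \<open>mean_normal_speed\<close>.\<close>

lemma abs_weighted_mean_le:
  fixes h h' v v' N :: real
  assumes "0 \<le> h" "0 \<le> h'" "h \<le> N" "h' \<le> N"
  shows "\<bar>1/2 * (h' * v' + h * v)\<bar> \<le> N * (1/2 * (\<bar>v'\<bar> + \<bar>v\<bar>))"
proof -
  have "\<bar>h' * v' + h * v\<bar> \<le> h' * \<bar>v'\<bar> + h * \<bar>v\<bar>"
    using abs_triangle_ineq[of "h' * v'" "h * v"] assms by (simp add: abs_mult)
  also have "\<dots> \<le> N * \<bar>v'\<bar> + N * \<bar>v\<bar>"
    using assms by (intro add_mono mult_right_mono) auto
  finally show ?thesis unfolding abs_mult by (simp add: distrib_left)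
qed

text \<open>The maximum in the denominator of \<xi> bounds all masses and weights that enter the
  flux, and cancels in the end; the minimum in the numerator is at most the mass of
  \<open>K\<close>.\<close>

lemma CFL_imp_normal_flux_bound:
  fixes S :: "('l::finite) state" and M :: mesh
  defines "R \<equiv> \<lambda>C. perimeter M C / area C"
  assumes unit: "norm (normal M K e) = 1"
    and dt: "0 < time_step P" and gam: "0 \<le> gam P" and \<beta>: "0 < \<beta>"
    and R: "0 \<le> R K" "0 \<le> R (neighbour M K e)"
    and mass: "0 \<le> mass S K $ i" "0 \<le> mass S (neighbour M K e) $ i"
    and weight: "0 \<le> weight S K $ i" "0 \<le> weight S (neighbour M K e) $ i"
    and CFL: "CFL M P \<beta> S i K e"
  shows "time_step P * R K * \<bar>flux M P S i K e \<bullet> normal M K e\<bar> \<le> \<beta> / (\<beta> + 1) * mass S K $ i"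
proof -
  let ?K' = "neighbour M K e"
  define r where "r = max (R K) (R ?K')"
  define N where "N = Max {weight S K $ i, weight S ?K' $ i, mass S K $ i, mass S ?K' $ i}"
  define \<mu> where "\<mu> = min (mass S K $ i) (mass S ?K' $ i)"
  define a where "a = mean_normal_speed M S i K e"
  define W where "W = weight_over_Delta M S i K e"
  define j where "j = (1/2 * (potential S ?K' $ i - potential S K $ i)) / (froude P)\<^sup>2"
  \<comment> \<open>The stabilization brings its own time step and ratio of perimeter to area.
    Scaled once more by both, it is quadratic in \<open>Y\<close>, hence the square roots
    here.\<close>
  define c where "c = sqrt (gam P) * sqrt \<bar>j\<bar>"
  define X where "X = time_step P * r * a"
  define Y where "Y = time_step P * r * c"
  have N: "weight S K $ i \<le> N" "weight S ?K' $ i \<le> N" "mass S K $ i \<le> N" "mass S ?K' $ i \<le> N"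
    unfolding N_def by (auto intro: Max_ge)
  have r: "0 \<le> r" "R K \<le> r" "R ?K' \<le> r"
    using R by (auto simp: r_def)
  have a: "0 \<le> a"
    by (simp add: a_def mean_normal_speed_def edge_mean_def)
  have c: "0 \<le> c" "c\<^sup>2 = gam P * \<bar>j\<bar>"
    using gam by (simp_all add: c_def power_mult_distrib)
  have "norm (scalar_jump M (\<lambda>C. potential S C $ i) K e) / (froude P)\<^sup>2 = \<bar>j\<bar>"
    using unit by (simp add: scalar_jump_def j_def abs_mult)
  then have XY: "X + Y \<le> \<beta> / (\<beta> + 1) * (\<mu> / N)"
    using CFL
    by (simp add: CFL_def xi_def Let_def X_def Y_def c_def a_def r_def R_def N_def \<mu>_def
        algebra_simps)
  have X0: "0 \<le> X" and Y0: "0 \<le> Y"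
    using a c r dt by (auto simp: X_def Y_def)
  have \<mu>: "0 \<le> \<mu>" "\<mu> \<le> mass S K $ i" "\<mu> \<le> N"
    using mass N by (auto simp: \<mu>_def)
  have \<beta>1: "0 \<le> \<beta> / (\<beta> + 1)" "\<beta> / (\<beta> + 1) \<le> 1"
    using \<beta> by auto
  \<comment> \<open>This includes \<open>N = 0\<close>, where the quotient is \<open>0\<close>. It
    serves to get \<open>Y \<le> 1\<close>, by which the quadratic term is absorbed into
    \<open>Y\<close>.\<close>
  have "\<mu> / N \<le> 1"
    using \<mu> by (auto simp: divide_le_eq_1)
  with \<beta>1 \<mu> have "\<beta> / (\<beta> + 1) * (\<mu> / N) \<le> 1"
    by (intro mult_le_one) auto
  with XY X0 have Y1: "Y \<le> 1" by linarith
  \<comment> \<open>The mean and the \<open>2\<close> in each denominator give two terms with factor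
    \<open>1/4\<close>, each at most \<open>N * r / 4\<close>.\<close>
  have W: "0 \<le> W" "W \<le> N * r / 2"
  proof -
    have W_eq: "W = (weight S K $ i * R K + weight S ?K' $ i * R ?K') / 4"
      by (simp add: W_def weight_over_Delta_def R_def Let_def field_simps)
    show "0 \<le> W" unfolding W_eq using weight R by (intro divide_nonneg_nonneg add_nonneg_nonneg mult_nonneg_nonneg) auto
    have "weight S K $ i * R K \<le> N * r" "weight S ?K' $ i * R ?K' \<le> N * r"
      using N r R weight mass by (auto intro!: mult_mono)
    then show "W \<le> N * r / 2" using W_eq by simp
  qed
  have N0: "0 \<le> N" using mass N by linarith
  have "\<bar>flux M P S i K e \<bullet> normal M K e\<bar> \<le>
      \<bar>edge_mean M (\<lambda>C. mass S C $ i * (velocity S C $ i \<bullet> normal M K e)) K e\<bar>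
      + \<bar>gam P * time_step P * W * j\<bar>"
    unfolding normal_flux_eq[OF unit] W_def j_def by (rule abs_triangle_ineq4)
  also have "\<bar>edge_mean M (\<lambda>C. mass S C $ i * (velocity S C $ i \<bullet> normal M K e)) K e\<bar> \<le> N * a"
    using abs_weighted_mean_le[OF mass N(3,4)]
    by (simp add: a_def mean_normal_speed_def edge_mean_def)
  also have "\<bar>gam P * time_step P * W * j\<bar> = time_step P * W * c\<^sup>2"
    using gam dt W by (simp add: abs_mult c)
  also have "\<dots> \<le> time_step P * (N * r / 2) * c\<^sup>2"
    using W dt by (intro mult_right_mono mult_left_mono) auto
  finally have F: "\<bar>flux M P S i K e \<bullet> normal M K e\<bar> \<le> N * a + time_step P * (N * r / 2) * c\<^sup>2"
    by simp
  have "time_step P * R K * \<bar>flux M P S i K e \<bullet> normal M K e\<bar> \<le>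
      time_step P * r * (N * a + time_step P * (N * r / 2) * c\<^sup>2)"
    using F r dt R by (intro mult_mono) auto
  also have "\<dots> = N * (X + Y * Y / 2)"
    by (simp add: X_def Y_def field_simps power2_eq_square)
  also have "\<dots> \<le> N * (X + Y)"
    using Y0 Y1 N0 mult_left_le[of Y Y] by (intro mult_left_mono) auto
  also have "\<dots> \<le> N * (\<beta> / (\<beta> + 1) * (\<mu> / N))"
    using XY N0 by (rule mult_left_mono)
  also have "\<dots> = \<beta> / (\<beta> + 1) * (N * (\<mu> / N))" by (rule mult.left_commute)
  \<comment> \<open>Either \<open>N\<close> cancels and leaves \<open>\<mu>\<close>, or
    \<open>N = 0\<close> and the left-hand side is \<open>0\<close>.\<close>
  also have "\<dots> \<le> \<beta> / (\<beta> + 1) * mass S K $ i"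
    using \<mu> mass by (intro mult_left_mono \<beta>1) (cases "N = 0"; simp)
  finally show ?thesis .
qed

text \<open>The share of \<open>h\<close> is at most \<beta>/(\<beta>+1) for outgoing
  \<open>f\<close>, where the negative part vanishes, and (1-\<beta>)/(1+\<beta>) for incoming
  \<open>f\<close>, where \<open>neg_part f = f\<close>.\<close>

lemma weighted_flux_parts_le:
  fixes k f h \<beta> :: real
  assumes k: "0 \<le> k" and h: "0 \<le> h" and \<beta>: "0 < \<beta>" "\<beta> \<le> 1"
    and kf: "k * \<bar>f\<bar> \<le> \<beta> / (\<beta> + 1) * h"
  shows "k * (f - 1 / \<beta> * neg_part f) \<le> h"
proof (cases "0 \<le> f")
  case True
  then have "k * (f - 1 / \<beta> * neg_part f) \<le> \<beta> / (\<beta> + 1) * h"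
    using kf by (simp add: neg_part_def)
  also have "\<dots> \<le> 1 * h"
    using h \<beta> by (intro mult_right_mono) auto
  finally show ?thesis by simp
next
  case False
  then have "k * (f - 1 / \<beta> * neg_part f) = (1 / \<beta> - 1) * (k * \<bar>f\<bar>)"
    by (simp add: neg_part_def algebra_simps)
  \<comment> \<open>The factor is nonnegative because \<beta> is at most 1.\<close>
  also have "\<dots> \<le> (1 / \<beta> - 1) * (\<beta> / (\<beta> + 1) * h)"
    using kf \<beta> by (intro mult_left_mono) auto
  also have "\<dots> = (1 - \<beta>) / (1 + \<beta>) * h"
  proof -
    have "(1 / \<beta> - 1) * \<beta> = 1 - \<beta>"
      using \<beta> by (simp add: left_diff_distrib)
    then show ?thesis
      by (simp add: add.commute flip: mult.assoc)
  qed
  also have "\<dots> \<le> 1 * h"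
    using h \<beta> by (intro mult_right_mono) auto
  finally show ?thesis by simp
qed

text \<open>The left-hand side is the average, with weights \<open>l e / sum l E\<close>, of values
  that are each at most \<open>h\<close>. If the total weight is zero, every weight vanishes and so
  does the sum.\<close>

lemma scaled_weighted_sum_le:
  fixes g l :: "'a \<Rightarrow> real"
  assumes l: "\<And>e. e \<in> E \<Longrightarrow> 0 \<le> l e" and h: "0 \<le> h"
    and le: "\<And>e. e \<in> E \<Longrightarrow> s * sum l E * g e \<le> h"
    and fin: "finite E"
  shows "s * (\<Sum>e\<in>E. g e * l e) \<le> h"
proof (cases "sum l E = 0")
  case True
  then have "\<forall>e\<in>E. l e = 0"
    using sum_nonneg_eq_0_iff[OF fin l] by simp
  then show ?thesis using h by simp
next
  case False
  then have pos: "0 < sum l E"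
    using sum_nonneg[OF l] by (simp add: order_less_le)
  define L where "L = sum l E"
  have "L * (s * (\<Sum>e\<in>E. g e * l e)) = (\<Sum>e\<in>E. (s * L * g e) * l e)"
    by (simp add: sum_distrib_left mult_ac)
  also have "\<dots> \<le> (\<Sum>e\<in>E. h * l e)"
    using le l unfolding L_def by (intro sum_mono mult_right_mono) auto
  also have "\<dots> = L * h"
    by (simp add: L_def sum_distrib_left mult.commute)
  finally show ?thesis
    using pos by (simp add: L_def mult_le_cancel_left_pos)
qed

theorem proposition3p2:
  fixes M :: mesh and P :: params and S :: "nat \<Rightarrow> ('l::finite) state" and n :: nat
    and \<beta> :: real
    and \<phi> :: "real^'l \<Rightarrow> real^2 \<Rightarrow> real^'l"
    and \<H> :: "real^'l \<Rightarrow> real^2 \<Rightarrow> real^'l^'l"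
    and pos :: "cell \<Rightarrow> real^2"
  assumes "tessellation M"
    and "froude P > 0" and "time_step P > 0" and "gam P \<ge> 0" and "alp P \<ge> 0"
    and "potential_law M P \<phi> \<H>"
    and "potential_from M \<phi> pos (S n)"
    and "\<forall>K\<in>cells M. \<forall>i. mass (S n) K $ i \<ge> 0"
    and "\<forall>K\<in>cells M. \<forall>i. weight (S n) K $ i \<ge> 0"
    and "scheme_step M P (S n) (S (Suc n))"
    and "0 < \<beta>" and "\<beta> \<le> 1"
    and "\<forall>K\<in>cells M. \<forall>e\<in>edges M K. \<forall>i. CFL M P \<beta> (S n) i K e"
  shows "\<forall>K\<in>cells M. \<forall>i.
      mass (S (Suc n)) K $ i \<ge>
        1 / \<beta> * (time_step P / area K) *
          (\<Sum>e\<in>edges M K. - neg_part (flux M P (S n) i K e \<bullet> normal M K e) * edge_length e) \<and>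
      1 / \<beta> * (time_step P / area K) *
          (\<Sum>e\<in>edges M K. - neg_part (flux M P (S n) i K e \<bullet> normal M K e) * edge_length e) \<ge> 0"
proof (intro ballI allI conjI)
  fix K i
  assume K: "K \<in> cells M"
  let ?F = "\<lambda>e. flux M P (S n) i K e \<bullet> normal M K e"
  let ?s = "time_step P / area K"
  have fin: "finite (edges M K)"
    using assms(1) K by (simp add: tessellation_def polygonal_cell_def)
  have s: "0 \<le> ?s"
    using assms(3) by (simp add: area_def)
  note len = tessellation_edge_length_nonneg[OF assms(1) K]
  note ratio = perimeter_area_ratio_nonneg[OF assms(1)]
  show "0 \<le> 1 / \<beta> * ?s * (\<Sum>e\<in>edges M K. - neg_part (?F e) * edge_length e)"
    using s assms(11) len neg_part_nonpos
    by (intro mult_nonneg_nonneg sum_nonneg) auto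
  have H: "0 \<le> mass (S n) K $ i"
    using assms(8) K by blast
  \<comment> \<open>Inserting the mass equation in the claimed lower bound and moving both sums to
    one side gives exactly this inequality.\<close>
  have "?s * (\<Sum>e\<in>edges M K. (?F e - 1 / \<beta> * neg_part (?F e)) * edge_length e)
      \<le> mass (S n) K $ i"
  \<comment> \<open>The weights are the edge lengths; their total is the perimeter, which yields the
    ratio of the CFL condition.\<close>
  proof (rule scaled_weighted_sum_le[OF len H _ fin])
    fix e
    assume e: "e \<in> edges M K"
    let ?K' = "neighbour M K e"
    have K': "?K' \<in> cells M" and unit: "norm (normal M K e) = 1"
      using assms(1) K e by (auto simp: tessellation_def outward_unit_normal_def)
    have "time_step P * (perimeter M K / area K) * \<bar>?F e\<bar> \<le> \<beta> / (\<beta> + 1) * mass (S n) K $ i"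
      using assms(8,9,13) K K' e
      by (intro CFL_imp_normal_flux_bound unit assms(3,4,11) ratio) auto
    then have "time_step P * (perimeter M K / area K) * (?F e - 1 / \<beta> * neg_part (?F e))
        \<le> mass (S n) K $ i"
      using assms(3) ratio[OF K] H
      by (intro weighted_flux_parts_le assms(11,12) mult_nonneg_nonneg) auto
    then show "?s * sum edge_length (edges M K) * (?F e - 1 / \<beta> * neg_part (?F e))
        \<le> mass (S n) K $ i"
      by (simp add: perimeter_def)
  qed
  moreover have "mass (S (Suc n)) K $ i
      = mass (S n) K $ i - ?s * (\<Sum>e\<in>edges M K. ?F e * edge_length e)"
    using assms(10) K by (simp add: scheme_step_def mass_equation_def)
  moreover have "(\<Sum>e\<in>edges M K. (?F e - 1 / \<beta> * neg_part (?F e)) * edge_length e)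
      = (\<Sum>e\<in>edges M K. ?F e * edge_length e)
        + 1 / \<beta> * (\<Sum>e\<in>edges M K. - neg_part (?F e) * edge_length e)"
    by (simp add: sum_distrib_left sum_negf sum_subtractf left_diff_distrib mult.assoc)
  ultimately show "1 / \<beta> * ?s * (\<Sum>e\<in>edges M K. - neg_part (?F e) * edge_length e)
      \<le> mass (S (Suc n)) K $ i"
    by (simp add: distrib_left add_divide_distrib mult.commute)
qed

end
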